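(* Let $Q,S\subset\mathbb Z$ be finite sets and let $\psi:Q\times S\to S$, $\phi:Q\times S\to Q$ be a Mealy automaton. Then there exists a stable extension of $(\psi,\phi)$, i.e. there are relative $(\max,+)$-functions $\tilde\psi,\tilde\phi:\mathbb R\times\mathbb R\to\mathbb R$ with $\tilde\psi|_{Q\times S}=\psi$, $\tilde\phi|_{Q\times S}=\phi$, and constants $0<\delta<1$, $0\le\mu<1$ such that the restrictions of $\tilde\psi$ and $\tilde\phi$ to the $\delta$-neighbourhood of each point of $Q\times S$ are Lipschitz with constant at most $\mu$.
   Context: A Mealy automaton is a pair $\psi:Q\times S\to S$, $\phi:Q\times S\to Q$ such that $\psi(q,\cdot):S\to S$ is a bijection for every $q\in Q$. A relative $(\max,+)$-function of $n$ variables is a function $\varphi:\mathbb R^n\to\mathbb R$ admitting (and equipped with) a presentation $\varphi(\bar x)=\max(\alpha_1+\bar a_1\cdot\bar x,\dots,\alpha_m+\bar a_m\cdot\bar x)-\max(\beta_1+\bar b_1\cdot\bar x,\dots,\beta_l+\bar b_l\cdot\bar x)$ with $\alpha_k,\beta_k\in\mathbb R$, $\bar a_k,\bar b_k\in\mathbb Q^n$. $\mathbb R^n$ carries the metric of the norm $|\bar x|=\max_i|x_i|$. *)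

theory Defs
  imports "HOL-Analysis.Analysis"
begin

text \<open>
  A Mealy automaton is given by total HOL functions, of which only the values on \<open>Q \<times> S\<close> matter.
\<close>

definition mealy_automaton ::
  "'q set \<Rightarrow> 's set \<Rightarrow> ('q \<times> 's \<Rightarrow> 's) \<Rightarrow> ('q \<times> 's \<Rightarrow> 'q) \<Rightarrow> bool" where
  "mealy_automaton Q S \<psi> \<phi> \<longleftrightarrow>
     \<psi> \<in> Q \<times> S \<rightarrow> S \<and> \<phi> \<in> Q \<times> S \<rightarrow> Q \<and>
     (\<forall>q\<in>Q. bij_betw (\<lambda>s. \<psi> (q, s)) S S)"

text \<open>
  The space of the variables is a Euclidean space with its standard basis, so that both
  \<open>real ^ 'n\<close> and \<open>real \<times> real\<close> are instances; membership of the slopes in the rational vectors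
  is a condition on their coordinates. Both maxima are over nonempty families.
\<close>

definition relative_maxplus :: "('a::euclidean_space \<Rightarrow> real) \<Rightarrow> bool" where
  "relative_maxplus f \<longleftrightarrow>
     (\<exists>(m::nat) (l::nat) (\<alpha>::nat \<Rightarrow> real) (a::nat \<Rightarrow> 'a) (\<beta>::nat \<Rightarrow> real) (b::nat \<Rightarrow> 'a).
        1 \<le> m \<and> 1 \<le> l \<and>
        (\<forall>k\<in>{1..m}. \<forall>i\<in>Basis. a k \<bullet> i \<in> \<rat>) \<and>
        (\<forall>k\<in>{1..l}. \<forall>i\<in>Basis. b k \<bullet> i \<in> \<rat>) \<and>
        (\<forall>x. f x = (MAX k\<in>{1..m}. \<alpha> k + a k \<bullet> x) - (MAX k\<in>{1..l}. \<beta> k + b k \<bullet> x)))"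

text \<open>
  The metric is the one of the maximum norm \<^const>\<open>infnorm\<close>; the library's \<^const>\<open>dist\<close>,
  and with it \<^const>\<open>ball\<close> and \<^const>\<open>lipschitz_on\<close>, is Euclidean on these spaces.
\<close>

lemma infnorm_real_pair: "infnorm (x :: real, y :: real) = max \<bar>x\<bar> \<bar>y\<bar>"
  by (simp add: infnorm_Max Basis_prod_def image_Un Max.union)

definition infnorm_ball :: "'a::euclidean_space \<Rightarrow> real \<Rightarrow> 'a set" where
  "infnorm_ball p \<delta> = {x. infnorm (x - p) < \<delta>}"

definition infnorm_lipschitz_on ::
  "real \<Rightarrow> 'a::euclidean_space set \<Rightarrow> ('a \<Rightarrow> real) \<Rightarrow> bool" where
  "infnorm_lipschitz_on L U f \<longleftrightarrow>
     0 \<le> L \<and> (\<forall>x\<in>U. \<forall>y\<in>U. \<bar>f x - f y\<bar> \<le> L * infnorm (x - y))"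

definition stable_extension ::
  "int set \<Rightarrow> int set \<Rightarrow> (int \<times> int \<Rightarrow> int) \<Rightarrow> (int \<times> int \<Rightarrow> int) \<Rightarrow>
   (real \<times> real \<Rightarrow> real) \<Rightarrow> (real \<times> real \<Rightarrow> real) \<Rightarrow> bool" where
  "stable_extension Q S \<psi> \<phi> \<psi>' \<phi>' \<longleftrightarrow>
     relative_maxplus \<psi>' \<and> relative_maxplus \<phi>' \<and>
     (\<forall>q\<in>Q. \<forall>s\<in>S. \<psi>' (real_of_int q, real_of_int s) = real_of_int (\<psi> (q, s))) \<and>
     (\<forall>q\<in>Q. \<forall>s\<in>S. \<phi>' (real_of_int q, real_of_int s) = real_of_int (\<phi> (q, s))) \<and>
     (\<exists>\<delta> \<mu>. 0 < \<delta> \<and> \<delta> < 1 \<and> 0 \<le> \<mu> \<and> \<mu> < 1 \<and>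
        (\<forall>q\<in>Q. \<forall>s\<in>S.
           infnorm_lipschitz_on \<mu> (infnorm_ball (real_of_int q, real_of_int s) \<delta>) \<psi>' \<and>
           infnorm_lipschitz_on \<mu> (infnorm_ball (real_of_int q, real_of_int s) \<delta>) \<phi>'))"

end

theory Submission
  imports Defs
begin

text \<open>
  Around a point \<open>p\<close>, with \<open>d = infnorm (x - p)\<close>, the bump \<open>max (4 d) 2 - max (4 d) 1\<close> is \<open>1\<close> for
  \<open>d \<le> 1/4\<close> and \<open>0\<close> for \<open>d \<ge> 1/2\<close>. Since distinct integer points have distance at least \<open>1\<close>,
  an integer combination of these bumps takes prescribed values at finitely many integer points and
  is constant near each of them, so that \<open>\<delta> = 1/4\<close> and \<open>\<mu> = 0\<close> serve.
\<close>

text \<open>These are tropical polynomials with rational exponents, that is, convex piecewise affine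
  functions. A finite set of pairs (constant, slope) replaces the indexed family of
  \<open>relative_maxplus\<close>, so that maxima and sums become unions and Minkowski sums without
  any reindexing.\<close>

definition maxplus :: "('a::euclidean_space \<Rightarrow> real) \<Rightarrow> bool" where
  "maxplus f \<longleftrightarrow>
     (\<exists>A. finite A \<and> A \<noteq> {} \<and> (\<forall>(\<alpha>, a)\<in>A. \<forall>i\<in>Basis. a \<bullet> i \<in> \<rat>) \<and>
          (\<forall>x. f x = (MAX (\<alpha>, a)\<in>A. \<alpha> + a \<bullet> x)))"

lemma maxplus_affine:
  assumes "\<forall>i\<in>Basis. a \<bullet> i \<in> \<rat>"
  shows "maxplus (\<lambda>x. \<alpha> + a \<bullet> x)"
  unfolding maxplus_def by (rule exI[of _ "{(\<alpha>, a)}"]) (use assms in auto)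

lemma maxplus_const: "maxplus (\<lambda>x. c)"
  using maxplus_affine[of 0 c] by simp

lemma maxplus_max:
  assumes "maxplus f" "maxplus g"
  shows "maxplus (\<lambda>x. max (f x) (g x))"
proof -
  from assms obtain A B where
    "finite A" "A \<noteq> {}" "\<forall>(\<alpha>, a)\<in>A. \<forall>i\<in>Basis. a \<bullet> i \<in> \<rat>"
    "\<forall>x. f x = (MAX (\<alpha>, a)\<in>A. \<alpha> + a \<bullet> x)"
    "finite B" "B \<noteq> {}" "\<forall>(\<alpha>, a)\<in>B. \<forall>i\<in>Basis. a \<bullet> i \<in> \<rat>"
    "\<forall>x. g x = (MAX (\<alpha>, a)\<in>B. \<alpha> + a \<bullet> x)"
    unfolding maxplus_def by blast
  then show ?thesis
    unfolding maxplus_def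
    by (intro exI[of _ "A \<union> B"]) (auto simp: image_Un Max_Un)
qed

text \<open>Addition distributes over maximum, so the sum of two maxima is the maximum over the
  Minkowski sum of the two sets of pairs.\<close>

lemma maxplus_add:
  assumes "maxplus f" "maxplus g"
  shows "maxplus (\<lambda>x. f x + g x)"
proof -
  from assms obtain A B where
    A: "finite A" "A \<noteq> {}" "\<forall>(\<alpha>, a)\<in>A. \<forall>i\<in>Basis. a \<bullet> i \<in> \<rat>"
    "\<forall>x. f x = (MAX (\<alpha>, a)\<in>A. \<alpha> + a \<bullet> x)" and
    B: "finite B" "B \<noteq> {}" "\<forall>(\<alpha>, a)\<in>B. \<forall>i\<in>Basis. a \<bullet> i \<in> \<rat>"
    "\<forall>x. g x = (MAX (\<alpha>, a)\<in>B. \<alpha> + a \<bullet> x)"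
    unfolding maxplus_def by blast
  define C where "C = (\<lambda>(u, v). u + v) ` (A \<times> B)"
  have "f x + g x = (MAX (\<alpha>, a)\<in>C. \<alpha> + a \<bullet> x)" for x
  proof (rule Max_eqI[symmetric])
    show "finite ((\<lambda>(\<alpha>, a). \<alpha> + a \<bullet> x) ` C)"
      using A(1) B(1) by (simp add: C_def)
    fix y assume "y \<in> (\<lambda>(\<alpha>, a). \<alpha> + a \<bullet> x) ` C"
    then obtain \<alpha> a \<beta> b where ab: "(\<alpha>, a) \<in> A" "(\<beta>, b) \<in> B"
      and y: "y = (\<alpha> + a \<bullet> x) + (\<beta> + b \<bullet> x)"
      by (auto simp: C_def inner_add_left)
    have "\<alpha> + a \<bullet> x \<le> f x" "\<beta> + b \<bullet> x \<le> g x"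
      unfolding A(4)[rule_format] B(4)[rule_format] using A(1) B(1) ab by (force intro!: Max_ge)+
    then show "y \<le> f x + g x"
      using y by simp
  next
    \<comment> \<open>Both maxima are attained since \<open>A\<close> and \<open>B\<close> are
      finite and nonempty; the sum of the two maximizing pairs lies in \<open>C\<close> and attains
      the bound.\<close>
    have "f x \<in> (\<lambda>(\<alpha>, a). \<alpha> + a \<bullet> x) ` A" "g x \<in> (\<lambda>(\<alpha>, a). \<alpha> + a \<bullet> x) ` B"
      unfolding A(4)[rule_format] B(4)[rule_format] using A(1,2) B(1,2) by (auto intro!: Max_in)
    then obtain \<alpha> a \<beta> b where "(\<alpha>, a) \<in> A" "(\<beta>, b) \<in> B"
      "f x = \<alpha> + a \<bullet> x" "g x = \<beta> + b \<bullet> x"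
      by auto
    then show "f x + g x \<in> (\<lambda>(\<alpha>, a). \<alpha> + a \<bullet> x) ` C"
      by (force simp: C_def inner_add_left image_iff)
  qed
  moreover have "finite C" "C \<noteq> {}"
    using A(1,2) B(1,2) by (simp_all add: C_def)
  moreover have "\<forall>(\<alpha>, a)\<in>C. \<forall>i\<in>Basis. a \<bullet> i \<in> \<rat>"
  proof clarify
    fix \<gamma> and c i :: 'a assume "(\<gamma>, c) \<in> C" and i: "i \<in> Basis"
    then obtain \<alpha> a \<beta> b where "(\<alpha>, a) \<in> A" "(\<beta>, b) \<in> B" "c = a + b"
      by (auto simp: C_def)
    moreover from this have "a \<bullet> i \<in> \<rat>" "b \<bullet> i \<in> \<rat>"
      using A(3) B(3) i by blast+
    ultimately show "c \<bullet> i \<in> \<rat>"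
      by (simp add: inner_add_left)
  qed
  ultimately show ?thesis
    unfolding maxplus_def by blast
qed

lemma maxplus_sum:
  assumes "\<And>i. i \<in> I \<Longrightarrow> maxplus (f i)"
  shows "maxplus (\<lambda>x. \<Sum>i\<in>I. f i x)"
  using assms
  by (induction I rule: infinite_finite_induct) (auto intro: maxplus_const maxplus_add)

text \<open>An n-fold sum. The factor is nonnegative because a negative one would turn the maximum
  into a minimum.\<close>

lemma maxplus_of_nat_mult:
  assumes "maxplus f"
  shows "maxplus (\<lambda>x. of_nat n * f x)"
  using maxplus_sum[of "{..<n}" "\<lambda>_. f"] assms by simp

lemma maxplus_Max:
  assumes "finite I" "I \<noteq> {}" "\<And>i. i \<in> I \<Longrightarrow> maxplus (f i)"
  shows "maxplus (\<lambda>x. MAX i\<in>I. f i x)"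
  using assms by (induction I rule: finite_ne_induct) (auto intro: maxplus_max)

text \<open>The norm is the maximum of the absolute values of the coordinates, and each of these is
  a maximum of two affine functions with slopes \<open>i\<close> and \<open>- i\<close>. The centre
  \<open>p\<close> enters only the constants, so its coordinates may be irrational.\<close>

lemma maxplus_infnorm: "maxplus (\<lambda>x. infnorm (x - p))"
proof -
  have "maxplus (\<lambda>x. max (- (p \<bullet> i) + i \<bullet> x) (p \<bullet> i + (- i) \<bullet> x))" if "i \<in> Basis" for i :: 'a
    using that by (intro maxplus_max maxplus_affine) (auto simp: inner_Basis)
  moreover have "max (- (p \<bullet> i) + i \<bullet> x) (p \<bullet> i + (- i) \<bullet> x) = \<bar>(x - p) \<bullet> i\<bar>" for i x :: 'a
    by (simp add: inner_diff_left inner_commute[of i] abs_real_def max_def)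
  ultimately have "maxplus (\<lambda>x. MAX i\<in>Basis. \<bar>(x - p) \<bullet> i\<bar>)"
    by (intro maxplus_Max) auto
  then show ?thesis
    by (simp add: infnorm_Max)
qed

text \<open>The passage from sets of pairs back to indexed families: each set is enumerated by
  \<open>{1..card A}\<close>.\<close>

lemma relative_maxplus_diff:
  assumes "maxplus f" "maxplus g"
  shows "relative_maxplus (\<lambda>x. f x - g x)"
proof -
  have *: "\<exists>(m::nat) \<alpha> a. 1 \<le> m \<and> (\<forall>k\<in>{1..m}. \<forall>i\<in>Basis. a k \<bullet> i \<in> \<rat>) \<and>
      (\<forall>x. h x = (MAX k\<in>{1..m}. \<alpha> k + a k \<bullet> x))"
    if "maxplus h" for h :: "'a \<Rightarrow> real"
  proof -
    from that obtain A where A: "finite A" "A \<noteq> {}"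
      "\<forall>(\<alpha>, a)\<in>A. \<forall>i\<in>Basis. a \<bullet> i \<in> \<rat>"
      "\<forall>x. h x = (MAX (\<alpha>, a)\<in>A. \<alpha> + a \<bullet> x)"
      unfolding maxplus_def by blast
    obtain e where "bij_betw e {1..card A} A"
      using ex_bij_betw_nat_finite_1[OF A(1)] by blast
    then have e: "A = e ` {1..card A}"
      by (simp add: bij_betw_def)
    have "(\<lambda>(\<alpha>, a). \<alpha> + a \<bullet> x) ` A = (\<lambda>k. fst (e k) + snd (e k) \<bullet> x) ` {1..card A}" for x
      by (subst e) (simp add: image_image case_prod_unfold)
    moreover have "\<forall>k\<in>{1..card A}. \<forall>i\<in>Basis. snd (e k) \<bullet> i \<in> \<rat>"
      using A(3) e by (auto simp: case_prod_unfold)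
    moreover have "1 \<le> card A"
      using A(1,2) by (simp add: Suc_le_eq card_gt_0_iff)
    ultimately show ?thesis
      using A(4) by (intro exI[of _ "card A"] exI[of _ "fst \<circ> e"] exI[of _ "snd \<circ> e"]) auto
  qed
  obtain m l :: nat and \<alpha> a \<beta> b where
    "1 \<le> m" "\<forall>k\<in>{1..m}. \<forall>i\<in>Basis. a k \<bullet> i \<in> \<rat>" "\<forall>x. f x = (MAX k\<in>{1..m}. \<alpha> k + a k \<bullet> x)"
    "1 \<le> l" "\<forall>k\<in>{1..l}. \<forall>i\<in>Basis. b k \<bullet> i \<in> \<rat>" "\<forall>x. g x = (MAX k\<in>{1..l}. \<beta> k + b k \<bullet> x)"
    using *[OF assms(1)] *[OF assms(2)] by blast
  then show ?thesis
    unfolding relative_maxplus_def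
    by - (rule exI[of _ m], rule exI[of _ l], rule exI[of _ \<alpha>], rule exI[of _ a],
      rule exI[of _ \<beta>], rule exI[of _ b], simp)
qed

lemma ex_relative_maxplus_locally_constant:
  fixes P :: "'a::euclidean_space set" and c :: "'a \<Rightarrow> int"
  assumes "finite P" and sep: "\<And>p r. p \<in> P \<Longrightarrow> r \<in> P \<Longrightarrow> p \<noteq> r \<Longrightarrow> 1 \<le> infnorm (p - r)"
  shows "\<exists>f. relative_maxplus f \<and> (\<forall>p\<in>P. \<forall>x\<in>infnorm_ball p (1/4). f x = of_int (c p))"
proof -
  \<comment> \<open>The bump at \<open>p\<close> is \<open>u p - v p\<close>. The form
    \<open>of_nat 4\<close> makes \<open>maxplus_of_nat_mult\<close> applicable.\<close>
  define u v :: "'a \<Rightarrow> 'a \<Rightarrow> real"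
    where "u p x = max (of_nat 4 * infnorm (x - p)) 2"
      and "v p x = max (of_nat 4 * infnorm (x - p)) 1" for p x
  \<comment> \<open>Each \<open>c p\<close> is split into its positive and negative parts. For the
    negative part \<open>u\<close> and \<open>v\<close> change sides, so both sums have only
    nonnegative coefficients and remain max-plus.\<close>
  define f where "f x = (\<Sum>p\<in>P. of_nat (nat (c p)) * u p x + of_nat (nat (- c p)) * v p x)
      - (\<Sum>p\<in>P. of_nat (nat (c p)) * v p x + of_nat (nat (- c p)) * u p x)" for x
  have "maxplus (u p)" "maxplus (v p)" for p
    unfolding u_def v_def
    by (intro maxplus_max maxplus_of_nat_mult maxplus_infnorm maxplus_const)+
  then have "relative_maxplus f"
    unfolding f_def
    by (intro relative_maxplus_diff maxplus_sum maxplus_add maxplus_of_nat_mult)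
  moreover have "f x = of_int (c p)" if p: "p \<in> P" and x: "x \<in> infnorm_ball p (1/4)" for p x
  proof -
    have px: "infnorm (x - p) < 1/4"
      using x by (simp add: infnorm_ball_def)
    \<comment> \<open>By the triangle inequality \<open>x\<close> is at distance more than 3/4 from
      \<open>r\<close>. Four times this exceeds both 2 and 1, so the two maxima coincide.\<close>
    have far: "u r x - v r x = 0" if "r \<in> P" "r \<noteq> p" for r
    proof -
      have "1 \<le> infnorm (p - r)"
        using sep p that by auto
      also have "p - r = (x - r) - (x - p)"
        by simp
      also have "infnorm \<dots> \<le> infnorm (x - r) + infnorm (x - p)"
        using infnorm_triangle[of "x - r" "- (x - p)"] infnorm_neg[of "x - p"] by simp
      finally show ?thesis
        using px by (simp add: u_def v_def)
    qed
    have "f x = (\<Sum>r\<in>P. of_int (c r) * (u r x - v r x))"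
      unfolding f_def sum_subtractf[symmetric]
    proof (rule sum.cong)
      fix r
      \<comment> \<open>According to the sign of \<open>c r\<close>, one of the two parts is zero
        and the other is the absolute value.\<close>
      show "of_nat (nat (c r)) * u r x + of_nat (nat (- c r)) * v r x
          - (of_nat (nat (c r)) * v r x + of_nat (nat (- c r)) * u r x)
          = of_int (c r) * (u r x - v r x)"
        by (cases "0 \<le> c r") (simp_all add: algebra_simps)
    qed simp
    also have "\<dots> = (\<Sum>r\<in>{p}. of_int (c r) * (u r x - v r x))"
      using assms(1) p far by (intro sum.mono_neutral_right) auto
    \<comment> \<open>Here four times the distance is below 1, so \<open>u p x\<close> is 2 and
      \<open>v p x\<close> is 1.\<close>
    also have "\<dots> = of_int (c p)"
      using px by (simp add: u_def v_def)
    finally show ?thesis .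
  qed
  ultimately show ?thesis
    by blast
qed

lemma ex_relative_maxplus_int_pair:
  fixes P :: "(int \<times> int) set" and c :: "int \<times> int \<Rightarrow> int"
  assumes "finite P"
  shows "\<exists>f. relative_maxplus f \<and>
    (\<forall>(q, s)\<in>P. \<forall>x\<in>infnorm_ball (real_of_int q, real_of_int s) (1/4). f x = of_int (c (q, s)))"
proof -
  let ?e = "\<lambda>(q, s). (real_of_int q, real_of_int s)"
  have "1 \<le> infnorm (?e p - ?e r)" if "?e p \<noteq> ?e r" for p r
  proof -
    have "1 \<le> \<bar>fst p - fst r\<bar> \<or> 1 \<le> \<bar>snd p - snd r\<bar>"
      using that by (auto simp: case_prod_unfold)
    then have "1 \<le> \<bar>real_of_int (fst p) - of_int (fst r)\<bar> \<or>
        1 \<le> \<bar>real_of_int (snd p) - of_int (snd r)\<bar>"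
      by linarith
    then show ?thesis
      by (auto simp: case_prod_unfold infnorm_real_pair)
  qed
  \<comment> \<open>The floors invert the embedding \<open>?e\<close> on its image, which turns
    \<open>c\<close> into a function on real points.\<close>
  then have "\<exists>f. relative_maxplus f \<and> (\<forall>p\<in>?e ` P. \<forall>x\<in>infnorm_ball p (1/4).
      f x = of_int (c (\<lfloor>fst p\<rfloor>, \<lfloor>snd p\<rfloor>)))"
    using assms
    by (intro ex_relative_maxplus_locally_constant[of _ "\<lambda>p. c (\<lfloor>fst p\<rfloor>, \<lfloor>snd p\<rfloor>)"]) auto
  then show ?thesis
    by (fastforce simp: case_prod_unfold)
qed

theorem lemma1p4:
  fixes Q S :: "int set" and \<psi> \<phi> :: "int \<times> int \<Rightarrow> int"
  assumes "finite Q" and "finite S"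
    and "mealy_automaton Q S \<psi> \<phi>"
  shows "\<exists>\<psi>' \<phi>'. stable_extension Q S \<psi> \<phi> \<psi>' \<phi>'"
proof -
  have fin: "finite (Q \<times> S)"
    using assms by simp
  obtain f g where fg: "relative_maxplus f" "relative_maxplus g"
    and f: "\<And>q s x. q \<in> Q \<Longrightarrow> s \<in> S \<Longrightarrow> x \<in> infnorm_ball (real_of_int q, real_of_int s) (1/4) \<Longrightarrow>
      f x = of_int (\<psi> (q, s))"
    and g: "\<And>q s x. q \<in> Q \<Longrightarrow> s \<in> S \<Longrightarrow> x \<in> infnorm_ball (real_of_int q, real_of_int s) (1/4) \<Longrightarrow>
      g x = of_int (\<phi> (q, s))"
    using ex_relative_maxplus_int_pair[OF fin, of \<psi>] ex_relative_maxplus_int_pair[OF fin, of \<phi>]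
    by auto
  \<comment> \<open>Taking \<open>x\<close> to be the centre of the ball turns local constancy into
    the interpolation of the values of the automaton.\<close>
  have centre: "p \<in> infnorm_ball p (1/4)" for p :: "real \<times> real"
    by (simp add: infnorm_ball_def infnorm_0)
  have "infnorm_lipschitz_on 0 (infnorm_ball (real_of_int q, real_of_int s) (1/4)) f"
    "infnorm_lipschitz_on 0 (infnorm_ball (real_of_int q, real_of_int s) (1/4)) g"
    if "q \<in> Q" "s \<in> S" for q s
    using that by (simp_all add: infnorm_lipschitz_on_def f g)
  then have "\<exists>\<delta> \<mu>. 0 < \<delta> \<and> \<delta> < 1 \<and> 0 \<le> \<mu> \<and> \<mu> < 1 \<and> (\<forall>q\<in>Q. \<forall>s\<in>S.
      infnorm_lipschitz_on \<mu> (infnorm_ball (real_of_int q, real_of_int s) \<delta>) f \<and>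
      infnorm_lipschitz_on \<mu> (infnorm_ball (real_of_int q, real_of_int s) \<delta>) g)"
    by - (rule exI[of _ "1/4"], rule exI[of _ 0], simp)
  then have "stable_extension Q S \<psi> \<phi> f g"
    unfolding stable_extension_def using fg f g centre by blast
  then show ?thesis
    by blast
qed

end
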